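(* Let $K,r\in[1,\infty)$ and suppose that, for each $i\in\mathbb N$, $f_i:\mathbb R\to\mathbb R$ is $K$-Lipschitz with $|f_i(0)|\le K$ and $g_i:\mathbb R\to\mathbb R$ is $1$-Lipschitz with $g_i(0)=0$. Let $h_d:\mathbb R^d\to\mathbb R$, $d\in\mathbb N$, be given by $h_1=f_1$ and $h_d(x)=g_d(\max\{h_{d-1}(x_1,\dots,x_{d-1}),f_d(x_d)\})$ for $d\ge2$. Then for all $d\in\mathbb N$ and $\varepsilon\in(0,1]$, there exists $\phi\in\mathcal N$ with $\mathcal R_{\mathrm{ReLU}}^\phi\in C(\mathbb R^d,\mathbb R)$ such that 1) $\sup_{x\in[-r,r]^d}|h_d(x)-\mathcal R_{\mathrm{ReLU}}^\phi(x)|\le\varepsilon$, 2) $\mathcal R_{\mathrm{ReLU}}^\phi$ is $K$-Lipschitz continuous on $\mathbb R^d$, and 3) $\mathcal P(\phi)\le\tfrac37\,10^4\,K^3\,r\,d^{13/2}\,\varepsilon^{-1}$.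
   Context: $\mathbb N=\{1,2,\dots\}$; Lipschitz continuity is with respect to the Euclidean norm. A skeleton is $\phi=[(V_1,b_1),\dots,(V_D,b_D)]$ with $D\in\mathbb N$, $l_0,\dots,l_D\in\mathbb N$, $V_k\in\mathbb R^{l_k\times l_{k-1}}$, $b_k\in\mathbb R^{l_k}$. $\mathcal N$ is the set of all skeletons, and the number of parameters is $\mathcal P(\phi)=\sum_{k=1}^D l_k(l_{k-1}+1)$. With $\mathrm{ReLU}(x)=\max\{x,0\}$ applied componentwise, the ReLU-realization is $\mathcal R_{\mathrm{ReLU}}^\phi=A_D\circ\mathrm{ReLU}\circ A_{D-1}\circ\cdots\circ\mathrm{ReLU}\circ A_1\in C(\mathbb R^{l_0},\mathbb R^{l_D})$ with $A_k(x)=V_kx+b_k$. *)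

theory Defs
  imports
    "HOL-Analysis.Lipschitz"
    "HOL-Library.Extended_Real"
    "Jordan_Normal_Form.Matrix"
begin

text \<open>
  Since the dimension is quantified over (and varies within a recursion), points of \<open>\<real>\<^sup>d\<close>
  are elements of \<open>carrier_vec d\<close>. Coordinates are counted from 0: the \<open>i\<close>-th coordinate of
  \<open>x\<close>, for \<open>i = 1, \<dots>, d\<close>, is \<open>vec_index x (i - 1)\<close>.
\<close>

definition euclidean_norm :: "real vec \<Rightarrow> real" where
  "euclidean_norm x = L2_set (vec_index x) {..<dim_vec x}"

definition lipschitz_on_Rn :: "real \<Rightarrow> nat \<Rightarrow> (real vec \<Rightarrow> real) \<Rightarrow> bool" where
  "lipschitz_on_Rn L d F \<longleftrightarrow> 0 \<le> L \<and>
     (\<forall>x \<in> carrier_vec d. \<forall>y \<in> carrier_vec d. \<bar>F x - F y\<bar> \<le> L * euclidean_norm (x - y))"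

definition cube :: "real \<Rightarrow> nat \<Rightarrow> real vec set" where
  "cube r d = {x \<in> carrier_vec d. \<forall>i<d. vec_index x i \<in> {-r..r}}"

type_synonym layer = "real mat \<times> real vec"

text \<open>
  The widths \<open>l 0, \<dots>, l D\<close> are determined by the matrices and vectors; the list index \<open>k\<close>
  carries the \<open>(k + 1)\<close>-st layer.
\<close>

definition skeletons :: "layer list set" where
  "skeletons = {\<phi>. \<exists>l :: nat \<Rightarrow> nat. \<phi> \<noteq> [] \<and> (\<forall>k\<le>length \<phi>. 1 \<le> l k) \<and>
     (\<forall>k<length \<phi>. fst (\<phi> ! k) \<in> carrier_mat (l (Suc k)) (l k) \<and>
                   snd (\<phi> ! k) \<in> carrier_vec (l (Suc k)))}"

definition input_dim :: "layer list \<Rightarrow> nat" where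
  "input_dim \<phi> = dim_col (fst (hd \<phi>))"

definition output_dim :: "layer list \<Rightarrow> nat" where
  "output_dim \<phi> = dim_row (fst (last \<phi>))"

definition num_params :: "layer list \<Rightarrow> nat" where
  "num_params \<phi> = (\<Sum>(V, b)\<leftarrow>\<phi>. dim_row V * (dim_col V + 1))"

definition ReLU :: "real \<Rightarrow> real" where
  "ReLU x = max x 0"

definition affine_layer :: "layer \<Rightarrow> real vec \<Rightarrow> real vec" where
  "affine_layer A x = fst A *\<^sub>v x + snd A"

text \<open>The value on the empty list is irrelevant, as skeletons are nonempty.\<close>

fun realization :: "layer list \<Rightarrow> real vec \<Rightarrow> real vec" where
  "realization [] x = x"
| "realization [A] x = affine_layer A x"
| "realization (A # B # \<phi>) x = realization (B # \<phi>) (map_vec ReLU (affine_layer A x))"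

text \<open>For output dimension 1, with \<open>\<real>\<^sup>1\<close> identified with \<open>\<real>\<close>:\<close>

definition scalar_realization :: "layer list \<Rightarrow> real vec \<Rightarrow> real" where
  "scalar_realization \<phi> x = vec_index (realization \<phi> x) 0"

lemma realization_carrier:
  assumes "\<phi> \<in> skeletons" "x \<in> carrier_vec (input_dim \<phi>)"
  shows "realization \<phi> x \<in> carrier_vec (output_dim \<phi>)"
proof -
  have *: "realization \<phi> x \<in> carrier_vec (l (length \<phi>))"
    if "\<phi> \<noteq> []" "\<forall>k<length \<phi>. fst (\<phi> ! k) \<in> carrier_mat (l (Suc k)) (l k) \<and>
                   snd (\<phi> ! k) \<in> carrier_vec (l (Suc k))" for l
    using that
  proof (induction \<phi> x arbitrary: l rule: realization.induct)
    case (3 A B \<phi> x)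
    have "\<forall>k<length (B # \<phi>). fst ((B # \<phi>) ! k) \<in> carrier_mat (l (Suc (Suc k))) (l (Suc k)) \<and>
                   snd ((B # \<phi>) ! k) \<in> carrier_vec (l (Suc (Suc k)))"
    proof (intro allI impI)
      fix k assume "k < length (B # \<phi>)"
      then have "Suc k < length (A # B # \<phi>)" by simp
      from "3.prems"(2)[rule_format, OF this]
      show "fst ((B # \<phi>) ! k) \<in> carrier_mat (l (Suc (Suc k))) (l (Suc k)) \<and>
            snd ((B # \<phi>) ! k) \<in> carrier_vec (l (Suc (Suc k)))" by simp
    qed
    from "3.IH"[of "\<lambda>k. l (Suc k)", OF _ this] show ?case by simp
  next
    case (2 A x)
    from "2.prems"(2)[rule_format, of 0] have "snd A \<in> carrier_vec (l (Suc 0))" by simp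
    then have "affine_layer A x \<in> carrier_vec (l (Suc 0))"
      unfolding affine_layer_def by (intro carrier_vecI) (simp only: index_add_vec carrier_vecD)
    then show ?case by simp
  qed simp
  obtain l where l: "\<phi> \<noteq> []" "\<forall>k<length \<phi>. fst (\<phi> ! k) \<in> carrier_mat (l (Suc k)) (l k) \<and>
                   snd (\<phi> ! k) \<in> carrier_vec (l (Suc k))"
    using assms(1) unfolding skeletons_def by blast
  have **: "output_dim \<phi> = l (length \<phi>)"
  proof -
    have "length \<phi> - 1 < length \<phi>" "Suc (length \<phi> - 1) = length \<phi>"
      using l(1) by simp_all
    with l(2)[rule_format, of "length \<phi> - 1"]
    have "fst (\<phi> ! (length \<phi> - 1)) \<in> carrier_mat (l (length \<phi>)) (l (length \<phi> - 1))"
      by simp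
    then show ?thesis by (simp add: output_dim_def last_conv_nth[OF l(1)])
  qed
  show ?thesis unfolding ** by (rule *[OF l])
qed

end

theory Submission
  imports Defs
begin

text \<open>
  Replace every \<open>f i\<close> and \<open>g i\<close> by its piecewise linear interpolant on a grid of \<open>N\<close> cells
  covering \<open>[-r, r]\<close> and \<open>[-R, R]\<close> with \<open>R = K (1 + r)\<close>, continued by constants. Interpolation
  preserves Lipschitz constants, so the resulting recursion is \<open>K\<close>-Lipschitz even for the maximum
  norm, and since each \<open>g i\<close> is 1-Lipschitz the interpolation errors only add up along the
  recursion; \<open>N\<close> of order \<open>d K r / \<epsilon>\<close> suffices. A network evaluates the recursion one
  coordinate at a time. Between two steps it stores only \<open>d + 2\<close> numbers, so each wide layer has
  narrow neighbours and the number of parameters is linear in \<open>N\<close>. All stored numbers are shifted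
  so as to be nonnegative, and are thus unaffected by the activation function.
\<close>

section \<open>Piecewise linear interpolation\<close>

lemma ReLU_nonneg [simp]: "0 \<le> ReLU x"
  by (simp add: ReLU_def)

lemma ReLU_eq [simp]: "0 \<le> x \<Longrightarrow> ReLU x = x"
  by (simp add: ReLU_def)

lemma abs_ReLU_diff_le: "\<bar>ReLU x - ReLU y\<bar> \<le> \<bar>x - y\<bar>"
  by (simp add: ReLU_def max_def)

lemma add_ReLU_diff: "x + ReLU (y - x) = max x y"
  by (simp add: ReLU_def max_def)

lemma abs_max_diff_le:
  fixes a b c d :: real
  assumes "\<bar>a - c\<bar> \<le> e" "\<bar>b - d\<bar> \<le> e"
  shows "\<bar>max a b - max c d\<bar> \<le> e"
  using assms by linarith

definition slope :: "(real \<Rightarrow> real) \<Rightarrow> real \<Rightarrow> nat \<Rightarrow> real" where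
  "slope F m k = (F (real (Suc k) * m) - F (real k * m)) / m"

text \<open>
  Cell \<open>k\<close> uses the unit \<open>2 k\<close> with knot \<open>k m\<close> and the unit \<open>2 k + 1\<close> with knot \<open>(k + 1) m\<close>.
\<close>

definition pl_weight :: "(real \<Rightarrow> real) \<Rightarrow> real \<Rightarrow> nat \<Rightarrow> real" where
  "pl_weight F m i = (if even i then slope F m (i div 2) else - slope F m (i div 2))"

definition pl_knot :: "real \<Rightarrow> nat \<Rightarrow> real" where
  "pl_knot m i = real (Suc i div 2) * m"

text \<open>Written in the form that one hidden layer with \<open>2 * N\<close> units computes. For
  \<open>0 < m\<close> it agrees with \<open>F\<close> at the knots \<open>0, m, ..., N * m\<close>
  and is constant outside the interval they span.\<close>

definition pl_interp :: "(real \<Rightarrow> real) \<Rightarrow> real \<Rightarrow> nat \<Rightarrow> real \<Rightarrow> real" where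
  "pl_interp F m N t = F 0 + (\<Sum>i<2 * N. pl_weight F m i * ReLU (t - pl_knot m i))"

text \<open>For \<open>0 <= m\<close> this rises from 0 to \<open>m\<close> with slope 1 across cell
  \<open>k\<close> and is constant elsewhere.\<close>

definition ramp :: "real \<Rightarrow> nat \<Rightarrow> real \<Rightarrow> real" where
  "ramp m k t = ReLU (t - real k * m) - ReLU (t - real (Suc k) * m)"

lemma pl_interp_eq: "pl_interp F m N t = F 0 + (\<Sum>k<N. slope F m k * ramp m k t)"
proof -
  have "(\<Sum>i<2 * N. pl_weight F m i * ReLU (t - pl_knot m i)) = (\<Sum>k<N. slope F m k * ramp m k t)"
  proof (induction N)
    case (Suc N)
    have "2 * Suc N = Suc (Suc (2 * N))" by simp
    then show ?case
      by (simp only: sum.lessThan_Suc Suc.IH)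
        (simp add: pl_weight_def pl_knot_def ramp_def algebra_simps)
  qed simp
  then show ?thesis by (simp add: pl_interp_def)
qed

lemma ramp_mono:
  assumes "0 \<le> m" "s \<le> t"
  shows "ramp m k s \<le> ramp m k t"
  using assms by (auto simp: ramp_def ReLU_def max_def algebra_simps)

lemma sum_ramp: "(\<Sum>k<N. ramp m k t) = ReLU t - ReLU (t - real N * m)"
  by (induction N) (simp_all add: ramp_def)

lemma ramp_at_knot:
  assumes "0 \<le> m"
  shows "ramp m k (real j * m) = (if k < j then m else 0)"
proof (cases "k < j")
  case True
  then have "real (Suc k) * m \<le> real j * m"
    using assms by (intro mult_right_mono) auto
  then show ?thesis using True assms by (simp add: ramp_def algebra_simps)
next
  case False
  then have "real j * m \<le> real k * m"
    using assms by (intro mult_right_mono) auto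
  then show ?thesis using False assms by (simp add: ramp_def ReLU_def algebra_simps)
qed

text \<open>The ramps of cells left of the knot have reached \<open>m\<close> and the others are
  still 0, so the increments of \<open>F\<close> telescope.\<close>

lemma pl_interp_at_knot:
  assumes "0 < m" "j \<le> N"
  shows "pl_interp F m N (real j * m) = F (real j * m)"
proof -
  have "(\<Sum>k<N. slope F m k * ramp m k (real j * m)) = (\<Sum>k<j. F (real (Suc k) * m) - F (real k * m))"
    using assms by (intro sum.mono_neutral_cong_right) (auto simp: ramp_at_knot slope_def)
  also have "\<dots> = F (real j * m) - F 0"
    by (subst sum_lessThan_telescope[where f = "\<lambda>k. F (real k * m)"]) simp
  finally show ?thesis by (simp add: pl_interp_eq)
qed

text \<open>All slopes are bounded by \<open>L\<close>, and all ramps are monotone. Hence their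
  increments add up without absolute values to the increment of their sum, which by
  \<open>sum_ramp\<close> is clipping to \<open>[0, N * m]\<close> and thus 1-Lipschitz.\<close>

lemma pl_interp_lipschitz:
  assumes "L-lipschitz_on UNIV F" "0 < m"
  shows "L-lipschitz_on UNIV (pl_interp F m N)"
proof (rule lipschitz_on_leI)
  show "0 \<le> L" using assms(1) by (rule lipschitz_on_nonneg)
  fix s t :: real
  assume "s \<le> t"
  have slope: "\<bar>slope F m k\<bar> \<le> L" for k
    using lipschitz_onD[OF assms(1), of "real (Suc k) * m" "real k * m"] \<open>0 < m\<close>
    by (simp add: slope_def dist_real_def divide_le_eq algebra_simps)
  have ramp: "ramp m k s \<le> ramp m k t" for k
    using ramp_mono \<open>0 < m\<close> \<open>s \<le> t\<close> by simp
  have "\<bar>pl_interp F m N s - pl_interp F m N t\<bar>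
      = \<bar>\<Sum>k<N. slope F m k * (ramp m k s - ramp m k t)\<bar>"
    by (simp add: pl_interp_eq sum_subtractf right_diff_distrib)
  also have "\<dots> \<le> (\<Sum>k<N. \<bar>slope F m k\<bar> * (ramp m k t - ramp m k s))"
    by (rule order_trans[OF sum_abs]) (use ramp in \<open>simp add: abs_mult\<close>)
  also have "\<dots> \<le> (\<Sum>k<N. L * (ramp m k t - ramp m k s))"
    using slope ramp by (intro sum_mono mult_right_mono) auto
  also have "\<dots> = L * ((\<Sum>k<N. ramp m k t) - (\<Sum>k<N. ramp m k s))"
    by (simp add: sum_distrib_left sum_subtractf right_diff_distrib)
  also have "\<dots> \<le> L * (t - s)"
    using \<open>0 \<le> L\<close> \<open>s \<le> t\<close> \<open>0 < m\<close>
    by (intro mult_left_mono) (auto simp: sum_ramp ReLU_def max_def)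
  finally show "dist (pl_interp F m N s) (pl_interp F m N t) \<le> L * dist s t"
    using \<open>s \<le> t\<close> by (simp add: dist_real_def)
qed

text \<open>The interpolant and \<open>F\<close> agree at the nearest knot to the left of
  \<open>t\<close>, and from there to \<open>t\<close> each of them moves by at most
  \<open>L * m\<close>.\<close>

lemma pl_interp_error:
  assumes "L-lipschitz_on UNIV F" "0 < m" "0 \<le> t" "t \<le> real N * m"
  shows "\<bar>pl_interp F m N t - F t\<bar> \<le> 2 * L * m"
proof -
  have L: "0 \<le> L" using assms(1) by (rule lipschitz_on_nonneg)
  define j where "j = nat \<lfloor>t / m\<rfloor>"
  have j: "real j \<le> t / m" "t / m < real j + 1"
    using assms by (simp_all add: j_def floor_le_iff)
  then have jm: "real j * m \<le> t" "t \<le> real j * m + m"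
    using \<open>0 < m\<close> by (auto simp: field_simps)
  have "t / m \<le> real N" using assms by (simp add: divide_le_eq)
  then have "j \<le> N" using j by linarith
  then have knot: "pl_interp F m N (real j * m) = F (real j * m)"
    using \<open>0 < m\<close> by (rule pl_interp_at_knot[rotated])
  have "L * \<bar>t - real j * m\<bar> \<le> L * m"
    using jm L by (intro mult_left_mono) auto
  then show ?thesis
    using lipschitz_onD[OF pl_interp_lipschitz[OF assms(1,2)], of t "real j * m" N]
      lipschitz_onD[OF assms(1), of t "real j * m"]
    by (simp add: dist_real_def knot)
qed

section \<open>Concatenation of layers\<close>

text \<open>Unlike \<open>realization\<close>, this activates after the last layer too, so that
  concatenation of lists becomes composition.\<close>

definition hidden :: "layer list \<Rightarrow> real vec \<Rightarrow> real vec" where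
  "hidden \<phi> = fold (\<lambda>A v. map_vec ReLU (affine_layer A v)) \<phi>"

lemma hidden_append: "hidden (\<phi> @ \<psi>) x = hidden \<psi> (hidden \<phi> x)"
  by (simp add: hidden_def)

lemma realization_snoc: "realization (\<phi> @ [A]) x = affine_layer A (hidden \<phi> x)"
proof (induction \<phi> arbitrary: x)
  case (Cons B \<phi>)
  then show ?case by (cases \<phi>) (simp_all add: hidden_def)
qed (simp add: hidden_def)

text \<open>A recursive form of the width condition in \<open>skeletons\<close>, with each width
  read off the bias, so that pieces of a network can be joined. Positivity of the input width has to
  be assumed separately.\<close>

fun layers_between :: "nat \<Rightarrow> layer list \<Rightarrow> nat \<Rightarrow> bool" where
  "layers_between n [] m \<longleftrightarrow> n = m"
| "layers_between n (A # \<phi>) m \<longleftrightarrow> fst A \<in> carrier_mat (dim_vec (snd A)) n \<and>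
     1 \<le> dim_vec (snd A) \<and> layers_between (dim_vec (snd A)) \<phi> m"

lemma layers_between_append:
  "layers_between n \<phi> l \<Longrightarrow> layers_between l \<psi> m \<Longrightarrow> layers_between n (\<phi> @ \<psi>) m"
  by (induction \<phi> arbitrary: n) auto

lemma layers_between_concat:
  "(\<And>\<phi>. \<phi> \<in> set \<Phi> \<Longrightarrow> layers_between n \<phi> n) \<Longrightarrow> layers_between n (concat \<Phi>) n"
  by (induction \<Phi>) (auto intro: layers_between_append)

lemma layers_between_widths:
  assumes "layers_between n \<phi> m" "1 \<le> n"
  shows "\<exists>l :: nat \<Rightarrow> nat. l 0 = n \<and> (\<forall>k\<le>length \<phi>. 1 \<le> l k) \<and>
     (\<forall>k<length \<phi>. fst (\<phi> ! k) \<in> carrier_mat (l (Suc k)) (l k) \<and>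
                   snd (\<phi> ! k) \<in> carrier_vec (l (Suc k)))"
  using assms
proof (induction \<phi> arbitrary: n)
  case Nil
  then show ?case by (intro exI[of _ "\<lambda>_. n"]) simp
next
  case (Cons A \<phi>)
  then obtain l where l: "l 0 = dim_vec (snd A)" "\<forall>k\<le>length \<phi>. 1 \<le> l k"
    "\<forall>k<length \<phi>. fst (\<phi> ! k) \<in> carrier_mat (l (Suc k)) (l k) \<and>
       snd (\<phi> ! k) \<in> carrier_vec (l (Suc k))"
    by (metis layers_between.simps(2))
  have "1 \<le> case_nat n l k" if "k \<le> length (A # \<phi>)" for k
    using l(2) \<open>1 \<le> n\<close> that by (cases k) simp_all
  moreover have "fst ((A # \<phi>) ! k) \<in> carrier_mat (case_nat n l (Suc k)) (case_nat n l k) \<and>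
      snd ((A # \<phi>) ! k) \<in> carrier_vec (case_nat n l (Suc k))" if "k < length (A # \<phi>)" for k
  proof (cases k)
    case 0
    then show ?thesis using l(1) Cons.prems(1) by simp
  next
    case (Suc j)
    then show ?thesis using l(3) that by simp
  qed
  ultimately show ?case
    by (intro exI[of _ "case_nat n l"]) simp
qed

lemma layers_between_skeletons:
  assumes "layers_between n \<phi> m" "1 \<le> n" "\<phi> \<noteq> []"
  shows "\<phi> \<in> skeletons"
  using layers_between_widths[OF assms(1,2)] assms(3) unfolding skeletons_def by blast

lemma layers_between_input_dim: "layers_between n \<phi> m \<Longrightarrow> \<phi> \<noteq> [] \<Longrightarrow> input_dim \<phi> = n"
  by (cases \<phi>) (auto simp: input_dim_def)

lemma layers_between_output_dim: "layers_between n \<phi> m \<Longrightarrow> \<phi> \<noteq> [] \<Longrightarrow> output_dim \<phi> = m"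
proof (induction \<phi> arbitrary: n)
  case (Cons A \<phi>)
  then show ?case by (cases "\<phi> = []") (auto simp: output_dim_def)
qed simp

lemma num_params_append: "num_params (\<phi> @ \<psi>) = num_params \<phi> + num_params \<psi>"
  by (simp add: num_params_def)

lemma num_params_concat_const:
  "(\<And>\<phi>. \<phi> \<in> set \<Phi> \<Longrightarrow> num_params \<phi> = p) \<Longrightarrow> num_params (concat \<Phi>) = length \<Phi> * p"
  by (induction \<Phi>) (auto simp: num_params_append num_params_def)

definition linear_layer :: "nat \<Rightarrow> nat \<Rightarrow> (nat \<Rightarrow> nat \<Rightarrow> real) \<Rightarrow> (nat \<Rightarrow> real) \<Rightarrow> layer" where
  "linear_layer m n Q b = (mat m n (\<lambda>(i, j). Q i j), vec m b)"

lemma affine_linear_layer: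
  assumes "v \<in> carrier_vec n"
  shows "affine_layer (linear_layer m n Q b) v = vec m (\<lambda>i. (\<Sum>j<n. Q i j * vec_index v j) + b i)"
  using assms
  by (intro eq_vecI)
    (auto simp: affine_layer_def linear_layer_def scalar_prod_def atLeast0LessThan)

lemma layers_between_linear_layer:
  "1 \<le> m \<Longrightarrow> layers_between n [linear_layer m n Q b] m"
  by (simp add: linear_layer_def)

lemma num_params_linear_layer: "num_params [linear_layer m n Q b] = m * (n + 1)"
  by (simp add: linear_layer_def num_params_def)

section \<open>Evaluating an interpolant on a stored state\<close>

text \<open>The middle layer holds the \<open>2 * N\<close> units of the interpolant, all fed by the
  functional \<open>p\<close> of the state, next to a copy of the state on which \<open>Q\<close>
  then acts.\<close>

definition unit_block ::
  "nat \<Rightarrow> nat \<Rightarrow> (real \<Rightarrow> real) \<Rightarrow> real \<Rightarrow> (nat \<Rightarrow> real) \<Rightarrow> nat \<Rightarrow> (nat \<Rightarrow> nat \<Rightarrow> real) \<Rightarrow> layer list"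
where
  "unit_block n N F m p i0 Q =
     [linear_layer (2 * N + n) n
        (\<lambda>i j. if i < 2 * N then p j else of_bool (j = i - 2 * N))
        (\<lambda>i. if i < 2 * N then - pl_knot m i else 0),
      linear_layer n (2 * N + n)
        (\<lambda>i j. if j < 2 * N then (if i = i0 then pl_weight F m j else 0) else Q i (j - 2 * N))
        (\<lambda>i. if i = i0 then F 0 else 0)]"

lemma sum_lessThan_add:
  fixes f :: "nat \<Rightarrow> real"
  shows "(\<Sum>j<M + n. f j) = (\<Sum>j<M. f j) + (\<Sum>j<n. f (M + j))"
  by (induction n) auto

text \<open>Nonnegative entries of \<open>v\<close> pass the activation of the middle layer
  unchanged, so the copy is exact.\<close>

lemma hidden_unit_block:
  assumes v: "v \<in> carrier_vec n" and nonneg: "\<And>i. i < n \<Longrightarrow> 0 \<le> vec_index v i"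
  shows "hidden (unit_block n N F m p i0 Q) v = vec n (\<lambda>i. ReLU ((\<Sum>j<n. Q i j * vec_index v j) +
    (if i = i0 then pl_interp F m N (\<Sum>j<n. p j * vec_index v j) else 0)))"
proof -
  define w where "w = vec (2 * N + n) (\<lambda>i. if i < 2 * N
    then ReLU ((\<Sum>j<n. p j * vec_index v j) - pl_knot m i) else vec_index v (i - 2 * N))"
  have w: "w \<in> carrier_vec (2 * N + n)" by (simp add: w_def)
  have pass: "(\<Sum>j<n. of_bool (j = i) * vec_index v j) = vec_index v i" if "i < n" for i
    using that by (simp add: of_bool_def if_distrib[of "\<lambda>c. c * _"] cong: if_cong)
  have "hidden (unit_block n N F m p i0 Q) v
    = map_vec ReLU (affine_layer (unit_block n N F m p i0 Q ! 1) w)"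
    unfolding unit_block_def hidden_def fold.simps comp_def id_def affine_linear_layer[OF v]
      nth_Cons_Suc nth_Cons_0 One_nat_def
    by (intro arg_cong[where f = "map_vec ReLU"] arg_cong2[where f = affine_layer] refl eq_vecI)
      (auto simp: w_def pass nonneg)
  also have "\<dots> = vec n (\<lambda>i. ReLU ((\<Sum>j<n. Q i j * vec_index v j) +
    (if i = i0 then pl_interp F m N (\<Sum>j<n. p j * vec_index v j) else 0)))"
    unfolding unit_block_def nth_Cons_Suc nth_Cons_0 One_nat_def affine_linear_layer[OF w]
    by (intro eq_vecI, simp_all add: sum_lessThan_add w_def pl_interp_def)
      (simp add: add.commute add.left_commute)
  finally show ?thesis .
qed

lemma layers_between_unit_block: "1 \<le> n \<Longrightarrow> layers_between n (unit_block n N F m p i0 Q) n"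
  by (simp add: unit_block_def linear_layer_def)

lemma num_params_unit_block:
  "num_params (unit_block n N F m p i0 Q) = (2 * N + n) * (n + 1) + n * (2 * N + n + 1)"
  by (simp add: unit_block_def linear_layer_def num_params_def)

section \<open>The network for a max-type recursion\<close>

text \<open>What the network computes on shifted data: each new value passes through the activation,
  and the initial 0 stands for the value \<open>-R\<close> before the shift.\<close>

fun max_rec :: "(nat \<Rightarrow> real \<Rightarrow> real) \<Rightarrow> (nat \<Rightarrow> real \<Rightarrow> real) \<Rightarrow> (nat \<Rightarrow> real) \<Rightarrow> nat \<Rightarrow> real" where
  "max_rec G F u 0 = 0"
| "max_rec G F u (Suc k) = ReLU (G k (max (max_rec G F u k) (F k (u k))))"

lemma max_rec_nonneg [simp]: "0 \<le> max_rec G F u k"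
  by (cases k) simp_all

text \<open>Maximum, \<open>G k\<close> and \<open>ReLU\<close> are all nonexpansive, so the
  constant \<open>L\<close> of the \<open>F k\<close> enters once and does not grow with
  \<open>k\<close>.\<close>

lemma max_rec_lipschitz:
  assumes "\<And>k. 1-lipschitz_on UNIV (G k)" "\<And>k. L-lipschitz_on UNIV (F k)"
    and "\<And>i. i < k \<Longrightarrow> \<bar>u i - v i\<bar> \<le> D" "0 \<le> D"
  shows "\<bar>max_rec G F u k - max_rec G F v k\<bar> \<le> L * D"
  using assms(3)
proof (induction k)
  case 0
  then show ?case using lipschitz_on_nonneg[OF assms(2)] \<open>0 \<le> D\<close> by simp
next
  case (Suc k)
  have F: "\<bar>F k (u k) - F k (v k)\<bar> \<le> L * D"
  proof -
    have "\<bar>F k (u k) - F k (v k)\<bar> \<le> L * \<bar>u k - v k\<bar>"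
      using lipschitz_onD[OF assms(2)[of k], of "u k" "v k"] by (simp add: dist_real_def)
    also have "\<dots> \<le> L * D"
      using Suc.prems[of k] lipschitz_on_nonneg[OF assms(2)] by (intro mult_left_mono) auto
    finally show ?thesis .
  qed
  have "\<bar>max_rec G F u k - max_rec G F v k\<bar> \<le> L * D"
    using Suc.prems by (intro Suc.IH) simp
  then have "\<bar>max (max_rec G F u k) (F k (u k)) - max (max_rec G F v k) (F k (v k))\<bar> \<le> L * D"
    using F by (rule abs_max_diff_le)
  then have "\<bar>G k (max (max_rec G F u k) (F k (u k))) - G k (max (max_rec G F v k) (F k (v k)))\<bar> \<le> L * D"
    using lipschitz_onD[OF assms(1)[of k]] by (simp add: dist_real_def) (meson order_trans)
  then show ?case
    using abs_ReLU_diff_le order_trans by (simp only: max_rec.simps) blast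
qed

text \<open>Each step adds one error \<open>\<delta>\<close> of \<open>G\<close>, while the errors
  \<open>\<gamma>\<close> of \<open>F\<close> are absorbed by the maximum and count only once.
  \<open>G\<close> is compared with \<open>G'\<close> at the exact argument, which is known to lie
  in \<open>[0, B]\<close>.\<close>

lemma max_rec_error:
  assumes lip: "\<And>k. 1-lipschitz_on UNIV (G k)"
    and errG: "\<And>k t. 0 \<le> t \<Longrightarrow> t \<le> B \<Longrightarrow> \<bar>G k t - G' k t\<bar> \<le> \<delta>"
    and errF: "\<And>k. k < d \<Longrightarrow> \<bar>F k (u k) - y k\<bar> \<le> \<gamma>"
    and y: "\<And>k. k < d \<Longrightarrow> 0 \<le> y k \<and> y k \<le> B"
    and \<eta>: "\<And>k. k \<le> d \<Longrightarrow> 0 \<le> \<eta> k \<and> \<eta> k \<le> B"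
    and \<eta>0: "\<eta> 0 = 0"
    and \<eta>_Suc: "\<And>k. k < d \<Longrightarrow> \<eta> (Suc k) = G' k (max (\<eta> k) (y k))"
    and nonneg: "0 \<le> \<delta>" "0 \<le> \<gamma>"
    and "k \<le> d"
  shows "\<bar>max_rec G F u k - \<eta> k\<bar> \<le> real k * \<delta> + \<gamma>"
  using \<open>k \<le> d\<close>
proof (induction k)
  case 0
  then show ?case using \<eta>0 nonneg by simp
next
  case (Suc k)
  then have k: "k < d" by simp
  define s where "s = max (\<eta> k) (y k)"
  define t where "t = max (max_rec G F u k) (F k (u k))"
  have s: "0 \<le> s" "s \<le> B"
    using y[OF k] \<eta>[of k] k by (auto simp: s_def)
  have "\<bar>F k (u k) - y k\<bar> \<le> real k * \<delta> + \<gamma>"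
    using errF[OF k] nonneg by (smt (verit) mult_nonneg_nonneg of_nat_0_le_iff)
  then have "\<bar>t - s\<bar> \<le> real k * \<delta> + \<gamma>"
    using Suc unfolding s_def t_def by (intro abs_max_diff_le) auto
  moreover have "\<bar>G k t - G k s\<bar> \<le> \<bar>t - s\<bar>"
    using lipschitz_onD[OF lip[of k], of t s] by (simp add: dist_real_def)
  moreover have "\<bar>ReLU (G k t) - ReLU (G' k s)\<bar> \<le> \<bar>G k t - G' k s\<bar>"
    by (rule abs_ReLU_diff_le)
  \<comment> \<open>The exact shifted value is nonnegative, so the activation does not alter
    it.\<close>
  moreover have "\<eta> (Suc k) = ReLU (G' k s)"
    using \<eta>[OF Suc.prems] \<eta>_Suc[OF k] by (simp add: s_def)
  ultimately show ?case
    using errG[OF s, of k] by (simp add: t_def[symmetric] algebra_simps)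
qed

text \<open>
  The state consists of the \<open>d\<close> shifted coordinates, the current value of the recursion (at index
  \<open>d\<close>), and a scratch entry (at index \<open>d + 1\<close>). With \<open>w\<close> the current value, the first block puts
  \<open>ReLU (F\<^sub>k (u\<^sub>k) - w)\<close> into the scratch entry, whose sum with \<open>w\<close> is \<open>max w (F\<^sub>k (u\<^sub>k))\<close>.
\<close>

definition state :: "nat \<Rightarrow> (nat \<Rightarrow> real) \<Rightarrow> real \<Rightarrow> real \<Rightarrow> real vec" where
  "state d u w z = vec (d + 2) (\<lambda>i. if i < d then u i else if i = d then w else z)"

text \<open>The second block applies the interpolant of \<open>G\<close> to the sum of the last two
  entries. Its matrix keeps only the coordinates, so the old value is overwritten and the scratch
  entry returns to 0.\<close>

definition stage ::
  "nat \<Rightarrow> nat \<Rightarrow> (real \<Rightarrow> real) \<Rightarrow> real \<Rightarrow> (real \<Rightarrow> real) \<Rightarrow> real \<Rightarrow> nat \<Rightarrow> layer list"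
where
  "stage d N G mG F mF k =
     unit_block (d + 2) N F mF (\<lambda>j. of_bool (j = k)) (d + 1)
       (\<lambda>i j. if i = d + 1 then - of_bool (j = d) else of_bool (j = i)) @
     unit_block (d + 2) N G mG (\<lambda>j. of_bool (d \<le> j)) d
       (\<lambda>i j. of_bool (j = i \<and> i < d))"

lemma hidden_stage:
  assumes "k < d" "\<And>i. i < d \<Longrightarrow> 0 \<le> u i" "0 \<le> w"
  shows "hidden (stage d N G mG F mF k) (state d u w 0) =
    state d u (ReLU (pl_interp G mG N (max w (pl_interp F mF N (u k))))) 0"
proof -
  define z where "z = ReLU (pl_interp F mF N (u k) - w)"
  have pick: "(\<Sum>j<n. of_bool (j = i) * c j) = c i" if "i < n" for i n and c :: "nat \<Rightarrow> real"
    using that by (simp add: of_bool_def if_distrib[of "\<lambda>c. c * _"] cong: if_cong)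
  have 1: "hidden (unit_block (d + 2) N F mF (\<lambda>j. of_bool (j = k)) (d + 1)
       (\<lambda>i j. if i = d + 1 then - of_bool (j = d) else of_bool (j = i))) (state d u w 0)
     = state d u w z"
    using assms
    by (subst hidden_unit_block)
      (auto simp: state_def z_def pick sum_negf intro!: eq_vecI)
  have t: "(\<Sum>j<d + 2. of_bool (d \<le> j) * vec_index (state d u w z) j) = max w (pl_interp F mF N (u k))"
  proof -
    have "(\<Sum>j<d. of_bool (d \<le> j) * vec_index (state d u w z) j) = 0"
      by (rule sum.neutral) simp
    then show ?thesis
      by (simp add: sum_lessThan_add numeral_2_eq_2 state_def z_def add_ReLU_diff)
  qed
  have "hidden (unit_block (d + 2) N G mG (\<lambda>j. of_bool (d \<le> j)) d
       (\<lambda>i j. of_bool (j = i \<and> i < d))) (state d u w z)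
     = state d u (ReLU (pl_interp G mG N (max w (pl_interp F mF N (u k))))) 0"
  proof (subst hidden_unit_block)
    show "state d u w z \<in> carrier_vec (d + 2)" by (simp add: state_def)
    show "0 \<le> vec_index (state d u w z) i" if "i < d + 2" for i
      using that assms by (simp add: state_def z_def)
    have "(\<Sum>j<d + 2. of_bool (j = i \<and> i < d) * vec_index (state d u w z) j) = (if i < d then u i else 0)" for i
    proof (cases "i < d")
      case True
      then show ?thesis by (simp add: pick del: sum.lessThan_Suc) (simp add: state_def)
    qed simp
    then show "vec (d + 2) (\<lambda>i. ReLU ((\<Sum>j<d + 2. of_bool (j = i \<and> i < d) * vec_index (state d u w z) j) +
        (if i = d then pl_interp G mG N (\<Sum>j<d + 2. of_bool (d \<le> j) * vec_index (state d u w z) j) else 0)))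
      = state d u (ReLU (pl_interp G mG N (max w (pl_interp F mF N (u k))))) 0"
      unfolding t using assms by (auto simp: state_def intro!: eq_vecI)
  qed
  then show ?thesis by (simp only: stage_def hidden_append 1)
qed

text \<open>The output layer can undo the shift by \<open>R\<close> because no activation follows
  it.\<close>

definition max_net :: "nat \<Rightarrow> nat \<Rightarrow> real \<Rightarrow> real \<Rightarrow> (nat \<Rightarrow> real \<Rightarrow> real) \<Rightarrow> real \<Rightarrow>
  (nat \<Rightarrow> real \<Rightarrow> real) \<Rightarrow> real \<Rightarrow> layer list" where
  "max_net d N r R G mG F mF =
     [linear_layer (d + 2) d (\<lambda>i j. of_bool (j = i)) (\<lambda>i. if i < d then r else 0)] @
     concat (map (\<lambda>k. stage d N (G k) mG (F k) mF k) [0..<d]) @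
     [linear_layer 1 (d + 2) (\<lambda>i j. of_bool (j = d)) (\<lambda>i. - R)]"

lemma layers_between_max_net: "layers_between d (max_net d N r R G mG F mF) 1"
  unfolding max_net_def
  by (intro layers_between_append[where l = "d + 2"] layers_between_concat layers_between_linear_layer)
    (auto simp: stage_def intro!: layers_between_append layers_between_unit_block)

lemma num_params_max_net:
  "num_params (max_net d N r R G mG F mF) = (d + 2) * (d + 1) +
     d * (2 * ((2 * N + (d + 2)) * (d + 3) + (d + 2) * (2 * N + (d + 2) + 1))) + (d + 3)"
proof -
  have "num_params (concat (map (\<lambda>k. stage d N (G k) mG (F k) mF k) [0..<d]))
    = d * (2 * ((2 * N + (d + 2)) * (d + 3) + (d + 2) * (2 * N + (d + 2) + 1)))"
    by (subst num_params_concat_const)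
      (auto simp: stage_def num_params_append num_params_unit_block algebra_simps)
  then show ?thesis
    by (simp only: max_net_def num_params_append num_params_linear_layer) simp
qed

text \<open>Valid on the whole space and not just on the cube, as the global Lipschitz bound
  requires.\<close>

lemma scalar_realization_max_net:
  assumes x: "x \<in> carrier_vec d"
  shows "scalar_realization (max_net d N r R G mG F mF) x =
    max_rec (\<lambda>k. pl_interp (G k) mG N) (\<lambda>k. pl_interp (F k) mF N) (\<lambda>i. ReLU (vec_index x i + r)) d - R"
proof -
  define u where "u = (\<lambda>i. ReLU (vec_index x i + r))"
  let ?W = "max_rec (\<lambda>k. pl_interp (G k) mG N) (\<lambda>k. pl_interp (F k) mF N) u"
  have pick: "(\<Sum>j<n. of_bool (j = i) * c j) = (if i < n then c i else 0)"
    for i n and c :: "nat \<Rightarrow> real"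
    by (simp add: of_bool_def if_distrib[of "\<lambda>c. c * _"] cong: if_cong)
  have init: "hidden [linear_layer (d + 2) d (\<lambda>i j. of_bool (j = i)) (\<lambda>i. if i < d then r else 0)] x
    = state d u 0 0"
    using x by (auto simp: hidden_def affine_linear_layer state_def u_def pick intro!: eq_vecI)
  have stages: "hidden (concat (map (\<lambda>k. stage d N (G k) mG (F k) mF k) [0..<k])) (state d u 0 0)
    = state d u (?W k) 0" if "k \<le> d" for k
    using that
  proof (induction k)
    case 0
    then show ?case by (simp add: hidden_def)
  next
    case (Suc k)
    then show ?case by (simp add: hidden_append hidden_stage u_def)
  qed
  have "state d u (?W d) 0 \<in> carrier_vec (d + 2)" by (simp add: state_def)
  then have "vec_index (affine_layer (linear_layer 1 (d + 2) (\<lambda>i j. of_bool (j = d)) (\<lambda>i. - R))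
      (state d u (?W d) 0)) 0 = ?W d - R"
    by (simp add: affine_linear_layer pick del: sum.lessThan_Suc) (simp add: state_def)
  then show ?thesis
    unfolding scalar_realization_def max_net_def append_assoc[symmetric] realization_snoc
      hidden_append init stages[OF order_refl] unfolding u_def .
qed

section \<open>Approximation of the recursion\<close>

lemma abs_vec_index_le_euclidean_norm:
  assumes "i < dim_vec x"
  shows "\<bar>vec_index x i\<bar> \<le> euclidean_norm x"
  using member_le_L2_set[of "{..<dim_vec x}" i "\<lambda>i. \<bar>vec_index x i\<bar>"] assms
  by (simp add: euclidean_norm_def L2_set_def)

text \<open>The bound of \<open>max_rec_lipschitz\<close> is in the maximum norm, which the
  Euclidean norm dominates.\<close>

lemma lipschitz_on_max_net:
  assumes "\<And>k. 1-lipschitz_on UNIV (G k)" "\<And>k. K-lipschitz_on UNIV (F k)" "0 < mG" "0 < mF"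
  shows "lipschitz_on_Rn K d (scalar_realization (max_net d N r R G mG F mF))"
  unfolding lipschitz_on_Rn_def
proof (intro conjI ballI)
  show "0 \<le> K" using assms(2) by (rule lipschitz_on_nonneg)
  fix x y :: "real vec"
  assume x: "x \<in> carrier_vec d" and y: "y \<in> carrier_vec d"
  have "\<bar>ReLU (vec_index x i + r) - ReLU (vec_index y i + r)\<bar> \<le> euclidean_norm (x - y)" if "i < d" for i
    using abs_ReLU_diff_le[of "vec_index x i + r" "vec_index y i + r"]
      abs_vec_index_le_euclidean_norm[of i "x - y"] that x y by simp
  then show "\<bar>scalar_realization (max_net d N r R G mG F mF) x
      - scalar_realization (max_net d N r R G mG F mF) y\<bar> \<le> K * euclidean_norm (x - y)"
    unfolding scalar_realization_max_net[OF x] scalar_realization_max_net[OF y]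
    using max_rec_lipschitz[OF pl_interp_lipschitz[OF assms(1,3)] pl_interp_lipschitz[OF assms(2,4)]]
    by (simp add: euclidean_norm_def)
qed

lemma max_net_size_bound:
  fixes K r \<epsilon> :: real
  assumes "1 \<le> K" "1 \<le> r" "1 \<le> d" "0 < \<epsilon>" "\<epsilon> \<le> 1" "real N \<le> 12 * (d * K * r / \<epsilon>) + 1"
  shows "real (num_params (max_net d N r' R G mG F mF))
    \<le> 3 / 7 * 10 ^ 4 * K ^ 3 * r * real d powr (13 / 2) * inverse \<epsilon>"
proof -
  define X where "X = d * K * r / \<epsilon>"
  define D where "D = real d"
  have D: "1 \<le> D" using \<open>1 \<le> d\<close> by (simp add: D_def)
  have Kr: "1 \<le> K * r / \<epsilon>"
    using assms mult_mono[of 1 K 1 r] by (simp add: le_divide_eq)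
  have X: "D \<le> X"
    using mult_left_mono[OF Kr, of D] D by (simp add: X_def D_def mult.assoc)
  \<comment> \<open>The left side is at most \<open>24 * X + D + 4\<close>, and
    \<open>1 <= D <= X\<close>.\<close>
  have N: "2 * real N + (D + 2) \<le> 29 * X"
    using assms(6) X D unfolding X_def[symmetric] by linarith
  have "real (num_params (max_net d N r' R G mG F mF)) = (D + 2) * (D + 1) +
     D * (2 * ((2 * real N + (D + 2)) * (D + 3) + (D + 2) * (2 * real N + (D + 2) + 1))) + (D + 3)"
    unfolding num_params_max_net D_def by (simp add: algebra_simps)
  also have "\<dots> \<le> (3 * D) * (2 * D) + D * (4 * ((29 * X) * (4 * D))) + 4 * D"
  proof (intro add_mono)
    show "(D + 2) * (D + 1) \<le> (3 * D) * (2 * D)"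
      using D by (intro mult_mono) auto
    have "(2 * real N + (D + 2)) * (D + 3) \<le> (29 * X) * (4 * D)"
      using N D by (intro mult_mono) auto
    moreover have "(D + 2) * (2 * real N + (D + 2) + 1) \<le> (2 * real N + (D + 2)) * (D + 3)"
      using D by (simp add: algebra_simps)
    moreover have "D * (2 * (a + b)) \<le> D * (4 * c)" if "a \<le> c" "b \<le> a" for a b c
      using that D by (intro mult_left_mono) auto
    ultimately show "D * (2 * ((2 * real N + (D + 2)) * (D + 3) + (D + 2) * (2 * real N + (D + 2) + 1)))
      \<le> D * (4 * ((29 * X) * (4 * D)))" by blast
  qed (use D in auto)
  \<comment> \<open>Here \<open>474 = 6 + 4 * 29 * 4 + 4\<close>; the first and last terms are
    absorbed using \<open>1 <= D\<close> and \<open>1 <= X\<close>.\<close>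
  also have "\<dots> \<le> 474 * (D ^ 2 * X)"
  proof -
    have "D * D \<le> D * D * X"
      using mult_left_mono[of 1 X "D * D"] D X by simp
    moreover have "D \<le> D * D" using mult_left_mono[of 1 D D] D by simp
    ultimately show ?thesis by (simp add: power2_eq_square algebra_simps)
  qed
  also have "\<dots> = 474 * (D ^ 3 * K * r * inverse \<epsilon>)"
    by (simp add: X_def D_def field_simps power2_eq_square power3_eq_cube)
  also have "\<dots> \<le> 3 / 7 * 10 ^ 4 * (real d powr (13 / 2) * K ^ 3 * r * inverse \<epsilon>)"
  proof (intro mult_mono)
    have "D ^ 3 = real d powr 3" using D powr_realpow[of D 3] by (simp add: D_def)
    also have "\<dots> \<le> real d powr (13 / 2)" using D by (intro powr_mono) (auto simp: D_def)
    finally show "D ^ 3 \<le> real d powr (13 / 2)" .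
    show "K \<le> K ^ 3" using power_increasing[of 1 3 K] assms(1) by simp
  qed (use assms D in auto)
  finally show ?thesis by (simp add: mult_ac)
qed

theorem proposition30:
  fixes K r :: real
    and f g :: "nat \<Rightarrow> real \<Rightarrow> real"
    and h :: "nat \<Rightarrow> real vec \<Rightarrow> real"
  assumes "1 \<le> K" and "1 \<le> r"
    and "\<And>i. 1 \<le> i \<Longrightarrow> K-lipschitz_on UNIV (f i)"
    and "\<And>i. 1 \<le> i \<Longrightarrow> \<bar>f i 0\<bar> \<le> K"
    and "\<And>i. 1 \<le> i \<Longrightarrow> 1-lipschitz_on UNIV (g i)"
    and "\<And>i. 1 \<le> i \<Longrightarrow> g i 0 = 0"
    and "\<And>x. x \<in> carrier_vec 1 \<Longrightarrow> h 1 x = f 1 (vec_index x 0)"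
    and "\<And>d x. 2 \<le> d \<Longrightarrow> x \<in> carrier_vec d \<Longrightarrow>
           h d x = g d (max (h (d - 1) (vec_first x (d - 1))) (f d (vec_index x (d - 1))))"
  shows "\<forall>d\<ge>1. \<forall>\<epsilon>\<in>{0<..1}. \<exists>\<phi>\<in>skeletons. input_dim \<phi> = d \<and> output_dim \<phi> = 1 \<and>
           (SUP x\<in>cube r d. ereal \<bar>h d x - scalar_realization \<phi> x\<bar>) \<le> ereal \<epsilon> \<and>
           lipschitz_on_Rn K d (scalar_realization \<phi>) \<and>
           real (num_params \<phi>) \<le> 3 / 7 * 10 ^ 4 * K ^ 3 * r * real d powr (13 / 2) * inverse \<epsilon>"
proof (intro allI impI ballI)
  fix d :: nat and \<epsilon> :: real
  assume d: "1 \<le> d" and "\<epsilon> \<in> {0<..1}"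
  then have \<epsilon>: "0 < \<epsilon>" "\<epsilon> \<le> 1" by auto
  \<comment> \<open>On the cube every \<open>f k\<close> is bounded by \<open>K + K * r = R\<close>.
    So are the values of the recursion, since each \<open>g k\<close> is nonexpansive and fixes
    0.\<close>
  define R where "R = K * (1 + r)"
  have R: "0 < R" "R \<le> 2 * K * r"
    using assms(1,2) mult_left_mono[of 1 r K] by (simp_all add: R_def algebra_simps add_pos_nonneg)
  \<comment> \<open>The total error will be \<open>(4 * d * R + 4 * K * r) / N\<close>; with
    \<open>R <= 2 * K * r\<close> and \<open>1 <= d\<close> the numerator is at most
    \<open>(8 + 4) * d * K * r\<close>.\<close>
  define N where "N = nat \<lceil>12 * (d * K * r / \<epsilon>)\<rceil>"
  have X: "0 < d * K * r / \<epsilon>" using assms(1,2) d \<epsilon> by simp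
  then have N: "12 * (d * K * r / \<epsilon>) \<le> real N" "real N \<le> 12 * (d * K * r / \<epsilon>) + 1"
    unfolding N_def by linarith+
  then have N0: "0 < real N" using X by linarith
  \<comment> \<open>Starting from the value \<open>-R\<close> below the range of \<open>f 1\<close>, the case \<open>h 1 = f 1\<close> becomes a step
    of the recursion with \<open>g 1\<close> replaced by the identity.\<close>
  define g' where "g' k = (if k = 0 then id else g (Suc k))" for k
  \<comment> \<open>Conjugation by translations moves the arguments to \<open>[0, 2 * r]\<close> and
    the values to \<open>[0, 2 * R]\<close>, the intervals covered by the grids of widths
    \<open>mF\<close> and \<open>mG\<close>.\<close>
  define F where "F k t = f (Suc k) (t - r) + R" for k t
  define G where "G k t = g' k (t - R) + R" for k t
  define mF where "mF = 2 * r / N"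
  define mG where "mG = 2 * R / N"
  define \<phi> where "\<phi> = max_net d N r R G mG F mF"
  have m: "0 < mF" "0 < mG" "real N * mF = 2 * r" "real N * mG = 2 * R"
    using N0 R assms(2) by (simp_all add: mF_def mG_def)
  have g'_lip: "\<bar>g' k s - g' k t\<bar> \<le> \<bar>s - t\<bar>" for k s t
    using lipschitz_onD[OF assms(5)[of "Suc k"], of s t] by (simp add: g'_def dist_real_def)
  have g'0: "g' k 0 = 0" for k
    using assms(6)[of "Suc k"] by (simp add: g'_def)
  have f_lip: "\<bar>f (Suc k) s - f (Suc k) t\<bar> \<le> K * \<bar>s - t\<bar>" for k s t
    using lipschitz_onD[OF assms(3)[of "Suc k"], of s t] by (simp add: dist_real_def)
  have F_lip: "K-lipschitz_on UNIV (F k)" for k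
  proof (rule lipschitz_onI)
    show "dist (F k s) (F k t) \<le> K * dist s t" for s t
      using f_lip[of k "s - r" "t - r"] by (simp add: F_def dist_real_def)
  qed (use assms(1) in simp)
  have G_lip: "1-lipschitz_on UNIV (G k)" for k
  proof (rule lipschitz_onI)
    show "dist (G k s) (G k t) \<le> 1 * dist s t" for s t
      using g'_lip[of k "s - R" "t - R"] by (simp add: G_def dist_real_def)
  qed simp
  have f_bound: "\<bar>f (Suc k) t\<bar> \<le> R" if "\<bar>t\<bar> \<le> r" for k t
  proof -
    have "K * \<bar>t\<bar> \<le> K * r" using that assms(1) by (intro mult_left_mono) auto
    then show ?thesis
      using f_lip[of k t 0] assms(4)[of "Suc k"] by (simp add: R_def algebra_simps)
  qed
  have error: "\<bar>h d x - scalar_realization \<phi> x\<bar> \<le> \<epsilon>" if "x \<in> cube r d" for x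
  proof -
    have x: "x \<in> carrier_vec d" and xr: "\<And>i. i < d \<Longrightarrow> \<bar>vec_index x i\<bar> \<le> r"
      using that by (auto simp: cube_def abs_le_iff)
    define \<eta> where "\<eta> k = (if k = 0 then - R else h k (vec_first x k))" for k
    have \<eta>_Suc: "\<eta> (Suc k) = g' k (max (\<eta> k) (f (Suc k) (vec_index x k)))" if "k < d" for k
    proof (cases "k = 0")
      case True
      then show ?thesis
        using assms(7)[of "vec_first x 1"] f_bound[OF xr[OF that], of k]
        by (simp add: \<eta>_def g'_def vec_first_def max_def)
    next
      case False
      moreover have "vec_first (vec_first x (Suc k)) k = vec_first x k"
        by (auto simp: vec_first_def)
      ultimately show ?thesis
        using assms(8)[of "Suc k" "vec_first x (Suc k)"]
        by (simp add: \<eta>_def g'_def) (simp add: vec_first_def)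
    qed
    have \<eta>_bound: "\<bar>\<eta> k\<bar> \<le> R" if "k \<le> d" for k
      using that
    proof (induction k)
      case 0
      then show ?case using R by (simp add: \<eta>_def)
    next
      case (Suc k)
      then have "\<bar>max (\<eta> k) (f (Suc k) (vec_index x k))\<bar> \<le> R"
        using f_bound[OF xr, of k k] by (auto simp: max_def)
      then show ?case
        using g'_lip[of k "max (\<eta> k) (f (Suc k) (vec_index x k))" 0] Suc.prems
        by (simp add: \<eta>_Suc g'0)
    qed
    \<comment> \<open>The exact recursion is compared after adding \<open>R\<close> to all its
      values; the maximum commutes with this shift.\<close>
    have "\<bar>max_rec (\<lambda>k. pl_interp (G k) mG N) (\<lambda>k. pl_interp (F k) mF N)
        (\<lambda>i. ReLU (vec_index x i + r)) d - (\<eta> d + R)\<bar> \<le> real d * (2 * 1 * mG) + 2 * K * mF"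
    proof (rule max_rec_error[where d = d and B = "2 * R" and G' = G
          and y = "\<lambda>k. f (Suc k) (vec_index x k) + R" and \<eta> = "\<lambda>k. \<eta> k + R"])
      show "1-lipschitz_on UNIV (pl_interp (G k) mG N)" for k
        using G_lip m(2) by (rule pl_interp_lipschitz)
      show "\<bar>pl_interp (G k) mG N t - G k t\<bar> \<le> 2 * 1 * mG" if "0 \<le> t" "t \<le> 2 * R" for k t
        using pl_interp_error[OF G_lip m(2) that(1)] that(2) by (simp add: m)
      show "\<bar>pl_interp (F k) mF N (ReLU (vec_index x k + r)) - (f (Suc k) (vec_index x k) + R)\<bar> \<le> 2 * K * mF"
        if "k < d" for k
        using pl_interp_error[OF F_lip m(1), of "vec_index x k + r" N k] xr[OF that]
        by (simp add: m F_def)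
      show "0 \<le> f (Suc k) (vec_index x k) + R \<and> f (Suc k) (vec_index x k) + R \<le> 2 * R" if "k < d" for k
        using f_bound[OF xr[OF that], of k] by linarith
      show "0 \<le> \<eta> k + R \<and> \<eta> k + R \<le> 2 * R" if "k \<le> d" for k
        using \<eta>_bound[OF that] by linarith
      show "\<eta> (Suc k) + R = G k (max (\<eta> k + R) (f (Suc k) (vec_index x k) + R))" if "k < d" for k
        by (simp add: \<eta>_Suc[OF that] G_def max_add_distrib_left[symmetric])
    qed (use m assms(1) in \<open>auto simp: \<eta>_def\<close>)
    also have "\<dots> = (4 * (d * R) + 4 * (K * r)) / N"
      by (simp add: mF_def mG_def add_divide_distrib)
    also have "\<dots> \<le> (12 * (d * K * r)) / N"
    proof (intro divide_right_mono)
      have "d * R \<le> d * (2 * K * r)" using R by (intro mult_left_mono) auto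
      moreover have "1 * (K * r) \<le> d * (K * r)"
        using d assms(1,2) by (intro mult_right_mono) auto
      ultimately show "4 * (d * R) + 4 * (K * r) \<le> 12 * (d * K * r)"
        by (simp add: mult.assoc)
    qed simp
    also have "\<dots> \<le> \<epsilon>"
      using N(1) N0 \<epsilon> by (simp add: field_simps)
    moreover have "\<eta> d = h d x"
    proof -
      have "vec_first x d = x" using x by (auto simp: vec_first_def)
      then show ?thesis using d by (simp add: \<eta>_def)
    qed
    ultimately show ?thesis
      unfolding \<phi>_def scalar_realization_max_net[OF x] by linarith
  qed
  have \<phi>: "layers_between d \<phi> 1" "\<phi> \<noteq> []"
    unfolding \<phi>_def by (rule layers_between_max_net, simp add: max_net_def)
  show "\<exists>\<phi>\<in>skeletons. input_dim \<phi> = d \<and> output_dim \<phi> = 1 \<and>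
           (SUP x\<in>cube r d. ereal \<bar>h d x - scalar_realization \<phi> x\<bar>) \<le> ereal \<epsilon> \<and>
           lipschitz_on_Rn K d (scalar_realization \<phi>) \<and>
           real (num_params \<phi>) \<le> 3 / 7 * 10 ^ 4 * K ^ 3 * r * real d powr (13 / 2) * inverse \<epsilon>"
  proof (intro bexI conjI)
    show "\<phi> \<in> skeletons" using \<phi>(1) d \<phi>(2) by (rule layers_between_skeletons)
    show "input_dim \<phi> = d" using \<phi> by (rule layers_between_input_dim)
    show "output_dim \<phi> = 1" using \<phi> by (rule layers_between_output_dim)
    show "(SUP x\<in>cube r d. ereal \<bar>h d x - scalar_realization \<phi> x\<bar>) \<le> ereal \<epsilon>"
      using error by (intro SUP_least) simp
    show "lipschitz_on_Rn K d (scalar_realization \<phi>)"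
      unfolding \<phi>_def using G_lip F_lip m(2,1) by (rule lipschitz_on_max_net)
    show "real (num_params \<phi>) \<le> 3 / 7 * 10 ^ 4 * K ^ 3 * r * real d powr (13 / 2) * inverse \<epsilon>"
      unfolding \<phi>_def using assms(1,2) d \<epsilon> N(2) by (rule max_net_size_bound)
  qed
qed

end
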